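(* Let $k,\ell$ be positive integers and put $v=\frac{\ell(\ell-2)k}{(\ell-1)^2-k}$. If there exists a resolvable $\left(\frac{(\ell-2)k}{(\ell-1)^2-k}, \frac{k}{\ell-1}, \frac{(\ell-1)^2-k}{\ell-1}\right)$-BIBD and $\lambda$ is a positive integer multiple of $\frac{k((\ell-1)^2-k)}{(\ell-1)^2}$, then there exists a $(v,k,\lambda)$-BIBD admitting a $0$-ULSE $\ell$-colouring. In particular, if such a resolvable BIBD exists, then there exists a symmetric $(v,k,\lambda)$-BIBD (with $\lambda=\frac{k((\ell-1)^2-k)}{(\ell-1)^2}$) admitting a $0$-ULSE $\ell$-colouring.
   Context: For positive integers $v,k,\lambda$ with $2\le k<v$, a $(v,k,\lambda)$-BIBD is a pair $(V,\mathcal{B})$ where $V$ is a set of $v$ points and $\mathcal{B}$ is a collection of $k$-element subsets of $V$ (blocks) such that every pair of distinct points lies in exactly $\lambda$ blocks. It is symmetric if it has exactly $v$ blocks. A BIBD is resolvable if its blocks can be partitioned into resolution classes, each of which is a partition of $V$. An $\ell$-colouring is a surjective map from $V$ onto a set of $\ell$ colours. A $0$-ULSE $\ell$-colouring is an $\ell$-colouring such that $(\ell-1)$ divides $k$ and in every block exactly one colour does not appear, while each of the other $\ell-1$ colours appears exactly $\frac{k}{\ell-1}$ times in that block. *)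

theory Defs
  imports Complex_Main "HOL-Library.Multiset" "HOL-Library.Disjoint_Sets"
begin

text \<open>Blocks form a multiset: repeated blocks are allowed, as is usual for BIBDs.\<close>

definition bibd :: "nat \<Rightarrow> nat \<Rightarrow> nat \<Rightarrow> 'a set \<Rightarrow> 'a set multiset \<Rightarrow> bool" where
  "bibd v k lam V \<B> \<longleftrightarrow>
     2 \<le> k \<and> k < v \<and> 0 < lam \<and>
     finite V \<and> card V = v \<and>
     (\<forall>B \<in># \<B>. B \<subseteq> V \<and> card B = k) \<and>
     (\<forall>x \<in> V. \<forall>y \<in> V. x \<noteq> y \<longrightarrow> size {#B \<in># \<B>. x \<in> B \<and> y \<in> B#} = lam)"

definition symmetric_design :: "'a set \<Rightarrow> 'a set multiset \<Rightarrow> bool" where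
  "symmetric_design V \<B> \<longleftrightarrow> size \<B> = card V"

text \<open>
  Blocks within one resolution class are disjoint and nonempty, hence distinct, so a class is a
  set of blocks; the same class may however occur several times in the resolution.
  For finite \<open>V\<close> every class is finite, so \<open>mset_set\<close> turns it into the multiset of its blocks.
\<close>

definition resolvable :: "'a set \<Rightarrow> 'a set multiset \<Rightarrow> bool" where
  "resolvable V \<B> \<longleftrightarrow>
     (\<exists>\<R> :: 'a set set multiset.
        (\<forall>P \<in># \<R>. partition_on V P) \<and> \<B> = (\<Sum>P \<in># \<R>. mset_set P))"

definition colouring :: "nat \<Rightarrow> 'c set \<Rightarrow> 'a set \<Rightarrow> ('a \<Rightarrow> 'c) \<Rightarrow> bool" where
  "colouring l C V f \<longleftrightarrow> finite C \<and> card C = l \<and> f ` V = C"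

text \<open>
  Truncated subtraction in \<open>l - 1\<close> is harmless: for \<open>l \<le> 1\<close> and \<open>k > 0\<close> the divisibility
  condition fails. The division \<open>k div (l - 1)\<close> is exact.
\<close>

definition zero_ulse_colouring ::
  "nat \<Rightarrow> 'c set \<Rightarrow> nat \<Rightarrow> 'a set \<Rightarrow> 'a set multiset \<Rightarrow> ('a \<Rightarrow> 'c) \<Rightarrow> bool" where
  "zero_ulse_colouring l C k V \<B> f \<longleftrightarrow>
     colouring l C V f \<and> (l - 1) dvd k \<and>
     (\<forall>B \<in># \<B>.
        (\<exists>!c. c \<in> C \<and> c \<notin> f ` B) \<and>
        (\<forall>c \<in> C. c \<in> f ` B \<longrightarrow> card {x \<in> B. f x = c} = k div (l - 1)))"

end

theory Submission imports Defs begin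

text \<open>
  Put \<open>q = l - 1\<close>, so that \<open>k = q k\<^sub>0\<close>, \<open>lam\<^sub>0 = q - k\<^sub>0\<close>
  and \<open>v\<^sub>0 (q - k\<^sub>0) = (q - 1) k\<^sub>0\<close>. Then the resolvable design has exactly \<open>q\<close> resolution
  classes, and it attains equality in Bose's inequality, so by a variance argument
  it is affine: blocks from different classes meet in \<open>k\<^sub>0\<^sup>2 / v\<^sub>0\<close> points.
  Take \<open>l\<close> coloured copies of the point set. The block indexed by a colour \<open>i\<close> and a point \<open>p\<close>
  meets the copy of each colour \<open>j \<noteq> i\<close> in the block through \<open>p\<close> of the class \<open>\<sigma> i j\<close>, where
  \<open>\<sigma>\<close> is an off-diagonal Latin square. Two points of the same colour lie in
  \<open>k\<^sub>0 lam\<^sub>0\<close> common blocks because \<open>\<sigma> _ j\<close> meets every class once; for points of different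
  colours the count \<open>(l - 2) k\<^sub>0\<^sup>2 / v\<^sub>0\<close> given by affineness is the same number.
\<close>

section \<open>Affine resolvable designs\<close>

text \<open>Classes are indexed by \<open>D\<close>, and \<open>blk d x\<close> is the block of class \<open>d\<close> through \<open>x\<close>.\<close>

locale resolved_design =
  fixes V :: "'a set" and D :: "'d set" and blk :: "'d \<Rightarrow> 'a \<Rightarrow> 'a set" and k lam :: nat
  assumes finite_V: "finite V" and finite_D: "finite D"
    and blk_subset: "\<lbrakk>d \<in> D; x \<in> V\<rbrakk> \<Longrightarrow> blk d x \<subseteq> V"
    and blk_refl: "\<lbrakk>d \<in> D; x \<in> V\<rbrakk> \<Longrightarrow> x \<in> blk d x"
    and blk_eq: "\<lbrakk>d \<in> D; x \<in> V; y \<in> blk d x\<rbrakk> \<Longrightarrow> blk d y = blk d x"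
    and card_blk: "\<lbrakk>d \<in> D; x \<in> V\<rbrakk> \<Longrightarrow> card (blk d x) = k"
    and pair_count: "\<lbrakk>x \<in> V; y \<in> V; x \<noteq> y\<rbrakk> \<Longrightarrow> card {d \<in> D. y \<in> blk d x} = lam"
begin

lemma blk_sym: "\<lbrakk>d \<in> D; x \<in> V; y \<in> V\<rbrakk> \<Longrightarrow> y \<in> blk d x \<longleftrightarrow> x \<in> blk d y"
  using blk_eq blk_refl by metis

lemma finite_blk: "\<lbrakk>d \<in> D; x \<in> V\<rbrakk> \<Longrightarrow> finite (blk d x)"
  using blk_subset finite_V finite_subset by blast

text \<open>Double counting of pairs of a class \<open>d\<close> and a point \<open>w\<close> of
  \<open>B\<close> in \<open>blk d u\<close>: the point \<open>u\<close> itself is counted by every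
  class, any other point by \<open>lam\<close> classes.\<close>

lemma sum_card_inter:
  assumes "B \<subseteq> V" "u \<in> B"
  shows "(\<Sum>d\<in>D. card (B \<inter> blk d u)) = card D + (card B - 1) * lam"
proof -
  have finB: "finite B" using assms finite_V finite_subset by blast
  have "(\<Sum>d\<in>D. card (B \<inter> blk d u)) = (\<Sum>d\<in>D. \<Sum>w | w \<in> B \<and> w \<in> blk d u. 1)"
    by (simp add: Int_def)
  also have "\<dots> = (\<Sum>w\<in>B. \<Sum>d | d \<in> D \<and> w \<in> blk d u. 1)"
    by (rule sum.swap_restrict[OF finite_D finB])
  also have "\<dots> = (\<Sum>w\<in>B. card {d \<in> D. w \<in> blk d u})" by simp
  also have "\<dots> = card {d \<in> D. u \<in> blk d u} + (\<Sum>w\<in>B - {u}. card {d \<in> D. w \<in> blk d u})"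
    using finB assms(2) by (rule sum.remove)
  also have "{d \<in> D. u \<in> blk d u} = D"
    using blk_refl assms by blast
  also have "(\<Sum>w\<in>B - {u}. card {d \<in> D. w \<in> blk d u}) = (\<Sum>w\<in>B - {u}. lam)"
    using assms by (intro sum.cong refl pair_count) auto
  finally show ?thesis using finB assms(2) by simp
qed

text \<open>The preceding count with \<open>B = V\<close>, where every summand is \<open>k\<close>.
  It serves later to compute the number of classes from the parameters.\<close>

lemma replication:
  assumes "x \<in> V"
  shows "card D * (k - 1) = (card V - 1) * lam"
proof -
  have "(\<Sum>d\<in>D. card (V \<inter> blk d x)) = (\<Sum>d\<in>D. k)"
    using assms blk_subset card_blk by (intro sum.cong refl) (simp add: Int_absorb1)
  then have eq: "card D * k = card D + (card V - 1) * lam"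
    using sum_card_inter[OF order_refl assms] by simp
  then show ?thesis by (simp add: diff_mult_distrib2)
qed

text \<open>By symmetry of the relation, a point \<open>u\<close> lies in \<open>blk d z\<close>
  exactly for the \<open>k\<close> points \<open>z\<close> of \<open>blk d u\<close>. The weights 1
  and \<open>a e\<close> give the first and second moments in the variance argument.\<close>

lemma sum_over_blocks:
  fixes h :: "'a \<Rightarrow> nat"
  assumes "B \<subseteq> V" "d \<in> D"
  shows "(\<Sum>z\<in>V. \<Sum>u\<in>B \<inter> blk d z. h u) = k * (\<Sum>u\<in>B. h u)"
proof -
  have finB: "finite B" using assms finite_V finite_subset by blast
  have "(\<Sum>z\<in>V. \<Sum>u\<in>B \<inter> blk d z. h u) = (\<Sum>z\<in>V. \<Sum>u | u \<in> B \<and> u \<in> blk d z. h u)"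
    by (simp add: Int_def)
  also have "\<dots> = (\<Sum>u\<in>B. \<Sum>z | z \<in> V \<and> u \<in> blk d z. h u)"
    by (rule sum.swap_restrict[OF finite_V finB])
  also have "\<dots> = (\<Sum>u\<in>B. k * h u)"
  proof (intro sum.cong refl)
    fix u assume "u \<in> B"
    then have u: "u \<in> V" using assms by blast
    then have "{z \<in> V. u \<in> blk d z} = blk d u"
      using blk_sym[OF assms(2)] blk_subset[OF assms(2)] by blast
    then show "(\<Sum>z | z \<in> V \<and> u \<in> blk d z. h u) = k * h u"
      using card_blk[OF assms(2) u] by simp
  qed
  finally show ?thesis by (simp add: sum_distrib_left)
qed

text \<open>
  Bose's variance argument: the squared deviations of the block intersection sizes from their
  mean sum to zero. Blocks are enumerated by their points, that is, each one \<open>k\<close> times.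
\<close>

lemma affine:
  assumes c: "c \<in> D" and d: "d \<in> D" and "c \<noteq> d" and x: "x \<in> V" and y: "y \<in> V"
    and q: "card D = lam + k" and v: "card V * lam = (card D - 1) * k"
  shows "card V * card (blk c x \<inter> blk d y) = k\<^sup>2"
proof -
  define B where "B = blk c x"
  define a where "a e z = card (B \<inter> blk e z)" for e z
  let ?E = "D - {c}"
  have BV: "B \<subseteq> V" and cardB: "card B = k"
    using c x blk_subset card_blk by (auto simp: B_def)
  have k0: "0 < k"
    using blk_refl[OF c x] finite_blk[OF c x] cardB by (auto simp: B_def card_gt_0_iff)
  have cardE: "card ?E = card D - 1" using c finite_D by simp
  have S1: "(\<Sum>e\<in>?E. \<Sum>z\<in>V. a e z) = (card D - 1) * k\<^sup>2"
  proof -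
    have "(\<Sum>e\<in>?E. \<Sum>z\<in>V. a e z) = (\<Sum>e\<in>?E. k\<^sup>2)"
      using sum_over_blocks[OF BV, of _ "\<lambda>_. 1"] cardB
      by (intro sum.cong refl) (simp add: a_def power2_eq_square)
    then show ?thesis using cardE by simp
  qed
  \<comment> \<open>The class \<open>c\<close> contributes \<open>k\<close>, as
    \<open>blk c u\<close> is \<open>B\<close> itself. What remains of the total is
    \<open>k * lam\<close> because \<open>card D = lam + k\<close>.\<close>
  have inner: "(\<Sum>e\<in>?E. a e u) = k * lam" if u: "u \<in> B" for u
  proof -
    have "a c u = k"
      using blk_eq[OF c x] u cardB by (simp add: a_def B_def)
    then have "k + (\<Sum>e\<in>?E. a e u) = card D + (k - 1) * lam"
      using sum_card_inter[OF BV u] sum.remove[OF finite_D c, of "\<lambda>e. a e u"] cardB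
      by (simp add: a_def)
    then show ?thesis
      using k0 q by (cases k) auto
  qed
  have S2: "(\<Sum>e\<in>?E. \<Sum>z\<in>V. (a e z)\<^sup>2) = k ^ 3 * lam"
  proof -
    \<comment> \<open>The function \<open>a e\<close> is constant on each block of class
      \<open>e\<close>, so a square is the sum of \<open>a e u\<close> over the \<open>a e z\<close>
      points \<open>u\<close> of the intersection.\<close>
    have "(\<Sum>z\<in>V. (a e z)\<^sup>2) = k * (\<Sum>u\<in>B. a e u)" if "e \<in> ?E" for e
    proof -
      have "(\<Sum>z\<in>V. (a e z)\<^sup>2) = (\<Sum>z\<in>V. \<Sum>u\<in>B \<inter> blk e z. a e u)"
      proof (intro sum.cong refl)
        fix z assume z: "z \<in> V"
        have "(\<Sum>u\<in>B \<inter> blk e z. a e u) = (\<Sum>u\<in>B \<inter> blk e z. a e z)"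
          using that z by (intro sum.cong refl) (simp add: a_def blk_eq)
        then show "(a e z)\<^sup>2 = (\<Sum>u\<in>B \<inter> blk e z. a e u)"
          by (simp add: a_def power2_eq_square)
      qed
      then show ?thesis using sum_over_blocks[OF BV] that by simp
    qed
    then have "(\<Sum>e\<in>?E. \<Sum>z\<in>V. (a e z)\<^sup>2) = k * (\<Sum>e\<in>?E. \<Sum>u\<in>B. a e u)"
      by (simp add: sum_distrib_left)
    also have "(\<Sum>e\<in>?E. \<Sum>u\<in>B. a e u) = (\<Sum>u\<in>B. \<Sum>e\<in>?E. a e u)"
      by (rule sum.swap)
    also have "\<dots> = (\<Sum>u\<in>B. k * lam)" using inner by simp
    finally show ?thesis using cardB by (simp add: power3_eq_cube)
  qed
  define n where "n = int (card V)"
  define r where "r = int (card D - 1)"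
  have v': "n * int lam = r * int k"
    unfolding n_def r_def using v by (metis of_nat_mult)
  \<comment> \<open>By \<open>S1\<close> the mean of \<open>a e z\<close> is
    \<open>k * k / n\<close>; scaling the deviation by \<open>n\<close> keeps it an integer.\<close>
  let ?dev = "\<lambda>e z. (n * int (a e z) - (int k)\<^sup>2)\<^sup>2"
  have "(\<Sum>e\<in>?E. \<Sum>z\<in>V. ?dev e z) =
      (\<Sum>e\<in>?E. \<Sum>z\<in>V. n\<^sup>2 * int ((a e z)\<^sup>2) - 2 * n * (int k)\<^sup>2 * int (a e z) + int k ^ 4)"
    by (intro sum.cong refl) (simp add: power2_eq_square power4_eq_xxxx algebra_simps)
  also have "\<dots> = n\<^sup>2 * int (\<Sum>e\<in>?E. \<Sum>z\<in>V. (a e z)\<^sup>2)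
      - 2 * n * (int k)\<^sup>2 * int (\<Sum>e\<in>?E. \<Sum>z\<in>V. a e z) + r * n * int k ^ 4"
    by (simp only: sum.distrib sum_subtractf sum_distrib_left[symmetric] of_nat_sum[symmetric]
        sum_constant cardE r_def n_def) simp
  \<comment> \<open>The cross term is minus twice the constant term, so second moment and constant
    term are left with opposite signs; they cancel by \<open>v'\<close>.\<close>
  also have "\<dots> = n * int k ^ 3 * (n * int lam) - n * int k ^ 3 * (r * int k)"
    unfolding S1 S2 of_nat_mult of_nat_power r_def[symmetric]
    by (simp add: power2_eq_square power3_eq_cube power4_eq_xxxx algebra_simps)
  also have "\<dots> = 0" using v' by simp
  finally have "(\<Sum>e\<in>?E. \<Sum>z\<in>V. ?dev e z) = 0" .
  then have "\<forall>e\<in>?E. (\<Sum>z\<in>V. ?dev e z) = 0"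
    using finite_D by (subst (asm) sum_nonneg_eq_0_iff) (auto intro: sum_nonneg)
  then have "(\<Sum>z\<in>V. ?dev d z) = 0" using d \<open>c \<noteq> d\<close> by blast
  then have "?dev d y = 0"
    using finite_V y by (subst (asm) sum_nonneg_eq_0_iff) auto
  then have "int (card V * a d y) = int (k\<^sup>2)" by (simp add: n_def)
  then have "card V * a d y = k\<^sup>2" by (simp only: of_nat_eq_iff)
  then show ?thesis by (simp only: a_def B_def)
qed

end

section \<open>From a multiset of resolution classes to indexed classes\<close>

lemma size_filter_partition:
  assumes V: "finite V" and P: "partition_on V P" and x: "x \<in> V"
  shows "size {#B \<in># mset_set P. x \<in> B \<and> y \<in> B#} = of_bool (\<exists>B\<in>P. x \<in> B \<and> y \<in> B)"
proof -
  have finP: "finite P" using finite_elements[OF V P] .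
  have "card {B \<in> P. x \<in> B \<and> y \<in> B} = 1" if "B \<in> P" "x \<in> B" "y \<in> B" for B
  proof -
    have "{B \<in> P. x \<in> B \<and> y \<in> B} = {B}"
      using partition_onD2[OF P] that by (auto simp: disjoint_def)
    then show ?thesis by simp
  qed
  moreover have "card {B \<in> P. x \<in> B \<and> y \<in> B} = 0" if "\<not> (\<exists>B\<in>P. x \<in> B \<and> y \<in> B)"
    using that by (auto intro!: card_eq_0_iff[THEN iffD2])
  ultimately show ?thesis
    using finP by (auto simp: filter_mset_mset_set)
qed

text \<open>Listing the multiset of classes gives repeated classes different indices. Since a class
  has at most one block through two given points, counting blocks becomes counting indices.\<close>

lemma resolvable_resolved_design:
  assumes bibd: "bibd v k lam V \<B>" and res: "resolvable V \<B>"
  obtains q :: nat and blk where "resolved_design V {..<q} blk k lam"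
proof -
  obtain \<R> where part: "\<forall>P \<in># \<R>. partition_on V P" and B: "\<B> = (\<Sum>P \<in># \<R>. mset_set P)"
    using res unfolding resolvable_def by blast
  have V: "finite V" and cardB: "\<And>B. B \<in># \<B> \<Longrightarrow> card B = k"
    and pairs: "\<And>x y. \<lbrakk>x \<in> V; y \<in> V; x \<noteq> y\<rbrakk> \<Longrightarrow> size {#B \<in># \<B>. x \<in> B \<and> y \<in> B#} = lam"
    using bibd unfolding bibd_def by auto
  obtain Rs where Rs: "mset Rs = \<R>" using ex_mset by blast
  \<comment> \<open>For \<open>x\<close> in \<open>V\<close> the union is over a single block, which
    makes a choice operator unnecessary.\<close>
  define blk where "blk d x = \<Union>{B \<in> Rs ! d. x \<in> B}" for d x
  have Rd: "partition_on V (Rs ! d)" if "d < length Rs" for d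
    using part Rs that by (metis nth_mem_mset)
  have inB: "B \<in># \<B>" if "d < length Rs" "B \<in> Rs ! d" for d B
  proof -
    have "Rs ! d \<in># \<R>" using Rs that by (metis nth_mem_mset)
    then show ?thesis
      using that finite_elements[OF V Rd[OF that(1)]]
      by (auto simp: B intro!: bexI[of _ "Rs ! d"])
  qed
  have blkI: "blk d x = B" if "d < length Rs" "B \<in> Rs ! d" "x \<in> B" for d x B
  proof -
    have "{B \<in> Rs ! d. x \<in> B} = {B}"
      using partition_onD2[OF Rd[OF that(1)]] that by (auto simp: disjoint_def)
    then show ?thesis by (simp add: blk_def)
  qed
  have ex: "\<exists>B \<in> Rs ! d. x \<in> B" if "d < length Rs" "x \<in> V" for d x
    using partition_onD1[OF Rd[OF that(1)]] that by blast
  have sub: "B \<subseteq> V" if "d < length Rs" "B \<in> Rs ! d" for d B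
    using partition_onD1[OF Rd[OF that(1)]] that by blast
  have filt: "size {#B \<in># (\<Sum>P\<in>#mset Ps. mset_set P). x \<in> B \<and> y \<in> B#} =
      (\<Sum>d<length Ps. of_bool (\<exists>B\<in>Ps ! d. x \<in> B \<and> y \<in> B))"
    if "\<forall>P\<in>set Ps. partition_on V P" "x \<in> V" for x y Ps
    using that(1)
    \<comment> \<open>The shifted sum splits off index 0, the head of the list.\<close>
    by (induction Ps) (simp_all add: size_filter_partition[OF V _ that(2)]
        sum.lessThan_Suc_shift del: sum.lessThan_Suc sum_of_bool_eq)
  show ?thesis
  proof (rule that[of "length Rs" blk], unfold_locales)
    show "blk d x \<subseteq> V" "x \<in> blk d x" "card (blk d x) = k"
      if "d \<in> {..<length Rs}" "x \<in> V" for d x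
    proof -
      have d: "d < length Rs" using that by simp
      obtain B where "B \<in> Rs ! d" "x \<in> B" using ex[OF d \<open>x \<in> V\<close>] by blast
      then show "blk d x \<subseteq> V" "x \<in> blk d x" "card (blk d x) = k"
        using blkI[OF d] sub[OF d] cardB inB[OF d] by auto
    qed
    show "blk d y = blk d x" if "d \<in> {..<length Rs}" "x \<in> V" "y \<in> blk d x" for d x y
    proof -
      have d: "d < length Rs" using that by simp
      obtain B where B: "B \<in> Rs ! d" "x \<in> B" using ex[OF d \<open>x \<in> V\<close>] by blast
      then have "y \<in> B" using blkI[OF d] that by simp
      then show ?thesis using blkI[OF d] B by metis
    qed
  next
    fix x y assume x: "x \<in> V" and y: "y \<in> V" and "x \<noteq> y"
    have "lam = (\<Sum>d<length Rs. of_bool (\<exists>B\<in>Rs ! d. x \<in> B \<and> y \<in> B))"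
      using pairs[OF x y \<open>x \<noteq> y\<close>] filt[of Rs x y] part Rs x
      unfolding B by force
    also have "\<dots> = (\<Sum>d<length Rs. of_bool (y \<in> blk d x))"
      by (intro sum.cong refl arg_cong[of _ _ of_bool]) (auto simp: blk_def)
    finally show "card {d \<in> {..<length Rs}. y \<in> blk d x} = lam" by (simp add: Int_def)
  qed (use V in simp_all)
qed

section \<open>Multiples and isomorphic copies of coloured designs\<close>

lemma size_filter_repeat_mset:
  "size {#x \<in># repeat_mset m M. P x#} = m * size {#x \<in># M. P x#}"
  by (induction m) simp_all

lemma in_repeat_msetD: "x \<in># repeat_mset m M \<Longrightarrow> x \<in># M"
  by (simp flip: count_greater_zero_iff)

text \<open>Together with the next lemma, this reaches every positive multiple of
  \<open>lam\<close>: the colour conditions concern single blocks and ignore multiplicity.\<close>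

lemma bibd_repeat:
  assumes "bibd v k lam V \<B>" "0 < m"
  shows "bibd v k (m * lam) V (repeat_mset m \<B>)"
  using assms by (auto simp: bibd_def size_filter_repeat_mset dest!: in_repeat_msetD)

lemma zero_ulse_colouring_repeat:
  assumes "zero_ulse_colouring l C k V \<B> f"
  shows "zero_ulse_colouring l C k V (repeat_mset m \<B>) f"
  using assms in_repeat_msetD unfolding zero_ulse_colouring_def by metis

lemma bibd_image:
  assumes bibd: "bibd v k lam V \<B>" and g: "inj_on g V"
  shows "bibd v k lam (g ` V) (image_mset ((`) g) \<B>)"
proof -
  have sub: "B \<subseteq> V" if "B \<in># \<B>" for B using bibd that by (auto simp: bibd_def)
  have "size {#B \<in># image_mset ((`) g) \<B>. g x \<in> B \<and> g y \<in> B#} =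
      size {#B \<in># \<B>. x \<in> B \<and> y \<in> B#}" if "x \<in> V" "y \<in> V" for x y
    unfolding filter_mset_image_mset size_image_mset
    using that sub inj_on_image_mem_iff[OF g]
    by (intro arg_cong[of _ _ size] filter_mset_cong refl) auto
  moreover have "card (g ` B) = card B" if "B \<in># \<B>" for B
    using card_image inj_on_subset[OF g sub[OF that]] by blast
  ultimately show ?thesis
    using bibd sub card_image[OF g] by (simp add: bibd_def image_mono) metis
qed

lemma zero_ulse_colouring_image:
  assumes col: "zero_ulse_colouring l C k V \<B> f" and g: "inj_on g V"
    and sub: "\<And>B. B \<in># \<B> \<Longrightarrow> B \<subseteq> V"
  shows "zero_ulse_colouring l C k (g ` V) (image_mset ((`) g) \<B>) (f \<circ> inv_into V g)"
proof -
  have img: "(f \<circ> inv_into V g) ` g ` B = f ` B" if "B \<subseteq> V" for B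
    unfolding image_comp[symmetric] inv_into_image_cancel[OF g that] ..
  have "card {x \<in> g ` B. (f \<circ> inv_into V g) x = c} = card {x \<in> B. f x = c}"
    if "B \<subseteq> V" for B c
  proof -
    have "{x \<in> g ` B. (f \<circ> inv_into V g) x = c} = g ` {x \<in> B. f x = c}"
      using that g by (auto simp: inv_into_f_f subset_iff)
    moreover have "inj_on g {x \<in> B. f x = c}"
      using that by (intro inj_on_subset[OF g]) blast
    ultimately show ?thesis by (simp add: card_image)
  qed
  then show ?thesis
    using col sub img by (simp add: zero_ulse_colouring_def colouring_def)
qed

section \<open>The coloured design\<close>

lemma sum_if_const:
  "finite A \<Longrightarrow> (\<Sum>x\<in>A. if P x then c else 0) = card {x \<in> A. P x} * (c::nat)"
  by (simp add: sum.If_cases Int_def)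

text \<open>An \<open>l \<times> l\<close> Latin square off the diagonal: \<open>j - i - 1\<close> modulo \<open>l\<close>.\<close>

definition offdiag :: "nat \<Rightarrow> nat \<Rightarrow> nat \<Rightarrow> nat" where
  "offdiag l i j = (if i < j then j - i - 1 else j + l - i - 1)"

lemma offdiag_less: "\<lbrakk>i < l; j < l; i \<noteq> j\<rbrakk> \<Longrightarrow> offdiag l i j < l - 1"
  by (auto simp: offdiag_def)

text \<open>Distinctness within a row ensures that a block uses different classes in different
  colours, as affineness requires.\<close>

lemma offdiag_neq:
  "\<lbrakk>i < l; j < l; j' < l; i \<noteq> j; i \<noteq> j'; j \<noteq> j'\<rbrakk> \<Longrightarrow> offdiag l i j \<noteq> offdiag l i j'"
  by (auto simp: offdiag_def split: if_splits)

text \<open>An injection between sets of size \<open>l - 1\<close>. It allows a sum over index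
  colours to be rewritten as a sum over all classes.\<close>

lemma bij_betw_offdiag:
  assumes "j < l"
  shows "bij_betw (\<lambda>i. offdiag l i j) ({..<l} - {j}) {..<l - 1}"
proof -
  have inj: "inj_on (\<lambda>i. offdiag l i j) ({..<l} - {j})"
    using assms by (auto simp: inj_on_def offdiag_def split: if_splits)
  have "(\<lambda>i. offdiag l i j) ` ({..<l} - {j}) \<subseteq> {..<l - 1}"
    using assms offdiag_less by auto
  moreover have "card ((\<lambda>i. offdiag l i j) ` ({..<l} - {j})) = card {..<l - 1}"
    using assms by (simp add: card_image[OF inj])
  ultimately show ?thesis
    using inj by (simp add: bij_betw_def card_subset_eq)
qed

text \<open>The assumptions \<open>classes\<close> and \<open>points\<close> are the division-free
  relations between the parameters that the lemma \<open>affine\<close> needs.\<close>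

locale affine_resolved_design = resolved_design V "{..<l - 1}" blk k lam
  for V :: "'a set" and l :: nat and blk :: "nat \<Rightarrow> 'a \<Rightarrow> 'a set" and k lam :: nat +
  assumes k_ge: "2 \<le> k" and k_less: "k < card V" and lam_pos: "0 < lam"
    and classes: "l - 1 = lam + k"
    and points: "card V * lam = (l - 2) * k"
begin

definition cblock :: "nat \<times> 'a \<Rightarrow> (nat \<times> 'a) set" where
  "cblock = (\<lambda>(i, p). SIGMA j:{..<l} - {i}. blk (offdiag l i j) p)"

text \<open>As a multiset image the family has \<open>l * card V\<close> members without any proof
  that \<open>cblock\<close> is injective.\<close>

definition cblocks :: "(nat \<times> 'a) set multiset" where
  "cblocks = image_mset cblock (mset_set ({..<l} \<times> V))"

lemma mem_cblocks: "B \<in># cblocks \<longleftrightarrow> (\<exists>i p. i < l \<and> p \<in> V \<and> B = cblock (i, p))"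
  using finite_V by (auto simp: cblocks_def)

lemma size_filter_cblocks:
  "size {#B \<in># cblocks. (j, x) \<in> B \<and> (j', y) \<in> B#} =
    (if j < l \<and> j' < l then \<Sum>i\<in>{..<l} - {j, j'}. 
      card {p \<in> V. x \<in> blk (offdiag l i j) p \<and> y \<in> blk (offdiag l i j') p} else 0)"
proof -
  let ?S = "{b \<in> {..<l} \<times> V. (j, x) \<in> cblock b \<and> (j', y) \<in> cblock b}"
  have "size {#B \<in># cblocks. (j, x) \<in> B \<and> (j', y) \<in> B#} = card ?S"
    using finite_V by (simp add: cblocks_def filter_mset_image_mset filter_mset_mset_set)
  moreover have "?S = (if j < l \<and> j' < l then SIGMA i:{..<l} - {j, j'}.
      {p \<in> V. x \<in> blk (offdiag l i j) p \<and> y \<in> blk (offdiag l i j') p} else {})"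
    by (auto simp: cblock_def)
  ultimately show ?thesis using finite_V by simp
qed

text \<open>As \<open>i\<close> varies, every class is used once in colour \<open>j\<close>. In
  \<open>lam\<close> of them \<open>x\<close> and \<open>y\<close> share a block, and then
  \<open>p\<close> ranges over its \<open>k\<close> points.\<close>

lemma pair_same_colour:
  assumes j: "j < l" and x: "x \<in> V" and y: "y \<in> V" and "x \<noteq> y"
  shows "size {#B \<in># cblocks. (j, x) \<in> B \<and> (j, y) \<in> B#} = k * lam"
proof -
  have fibre: "card {p \<in> V. x \<in> blk d p \<and> y \<in> blk d p} = (if y \<in> blk d x then k else 0)"
    if "d < l - 1" for d
  proof -
    have "{p \<in> V. x \<in> blk d p} = blk d x"
      using that x blk_sym[of d] blk_subset[of d x] by auto
    moreover have "blk d p = blk d x" if "p \<in> blk d x" for p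
      using blk_eq \<open>d < l - 1\<close> x that by simp
    ultimately have "{p \<in> V. x \<in> blk d p \<and> y \<in> blk d p} =
        (if y \<in> blk d x then blk d x else {})"
      by auto
    then show ?thesis using card_blk that x by simp
  qed
  have "size {#B \<in># cblocks. (j, x) \<in> B \<and> (j, y) \<in> B#} =
      (\<Sum>i\<in>{..<l} - {j}. card {p \<in> V. x \<in> blk (offdiag l i j) p \<and> y \<in> blk (offdiag l i j) p})"
    using j by (simp add: size_filter_cblocks)
  also have "\<dots> = (\<Sum>d<l - 1. card {p \<in> V. x \<in> blk d p \<and> y \<in> blk d p})"
    by (rule sum.reindex_bij_betw[OF bij_betw_offdiag[OF j]])
  also have "\<dots> = (\<Sum>d<l - 1. if y \<in> blk d x then k else 0)"
    using fibre by simp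
  also have "\<dots> = lam * k"
    unfolding sum_if_const[OF finite_lessThan] using pair_count[OF x y \<open>x \<noteq> y\<close>] by simp
  finally show ?thesis by simp
qed

text \<open>For each of the \<open>l - 2\<close> remaining index colours, \<open>p\<close> ranges
  over the intersection of two blocks from different classes. Its size is known from
  \<open>affine\<close> only after multiplication by \<open>card V\<close>, a positive factor
  cancelled at the end.\<close>

lemma pair_different_colour:
  assumes j: "j < l" and j': "j' < l" and "j \<noteq> j'" and x: "x \<in> V" and y: "y \<in> V"
  shows "size {#B \<in># cblocks. (j, x) \<in> B \<and> (j', y) \<in> B#} = k * lam"
proof -
  let ?c = "\<lambda>i. card {p \<in> V. x \<in> blk (offdiag l i j) p \<and> y \<in> blk (offdiag l i j') p}"
  have fibre: "card V * ?c i = k\<^sup>2" if "i \<in> {..<l} - {j, j'}" for i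
  proof -
    have d: "offdiag l i j < l - 1" "offdiag l i j' < l - 1" "offdiag l i j \<noteq> offdiag l i j'"
      using that j j' \<open>j \<noteq> j'\<close> offdiag_less offdiag_neq by auto
    then have "{p \<in> V. x \<in> blk (offdiag l i j) p \<and> y \<in> blk (offdiag l i j') p} =
        blk (offdiag l i j) x \<inter> blk (offdiag l i j') y"
      using x y blk_sym[of "offdiag l i j"] blk_sym[of "offdiag l i j'"]
        blk_subset[of "offdiag l i j" x] by auto
    then show ?thesis
      using affine[of "offdiag l i j" "offdiag l i j'" x y] d x y points
      by (simp add: classes[symmetric] numeral_2_eq_2)
  qed
  have "card V * size {#B \<in># cblocks. (j, x) \<in> B \<and> (j', y) \<in> B#} =
      (\<Sum>i\<in>{..<l} - {j, j'}. card V * ?c i)"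
    using j j' by (simp add: size_filter_cblocks sum_distrib_left)
  also have "\<dots> = (\<Sum>i\<in>{..<l} - {j, j'}. k\<^sup>2)" using fibre by (intro sum.cong refl)
  also have "\<dots> = (l - 2) * k\<^sup>2" using j j' \<open>j \<noteq> j'\<close> by (simp add: card_Diff_subset numeral_2_eq_2)
  also have "\<dots> = card V * (k * lam)" using points by (simp add: power2_eq_square ac_simps)
  finally show ?thesis using k_less by simp
qed

lemma cblock_fibre:
  assumes "i < l" "p \<in> V" "j < l" "j \<noteq> i"
  shows "{b \<in> cblock (i, p). fst b = j} = {j} \<times> blk (offdiag l i j) p"
  using assms by (auto simp: cblock_def)

lemma bibd_cblocks: "bibd (l * card V) ((l - 1) * k) (k * lam) ({..<l} \<times> V) cblocks"
  unfolding bibd_def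
proof (intro conjI ballI impI)
  show "2 \<le> (l - 1) * k" using classes k_ge lam_pos
    by (metis add_leE le_trans mult_le_mono1 mult_1 Suc_leI add_gr_0 One_nat_def)
  have "(l - 1) * k \<le> (l - 1) * card V" using k_less by simp
  also have "\<dots> < l * card V" using classes lam_pos k_less by simp
  finally show "(l - 1) * k < l * card V" .
  show "0 < k * lam" using k_ge lam_pos by simp
  show "finite ({..<l} \<times> V)" "card ({..<l} \<times> V) = l * card V"
    using finite_V by (simp_all add: card_cartesian_product)
next
  fix B assume "B \<in># cblocks"
  then obtain i p where ip: "i < l" "p \<in> V" and B: "B = cblock (i, p)"
    using mem_cblocks by blast
  have "blk (offdiag l i j) p \<subseteq> V" if "j < l" "j \<noteq> i" for j
    using that ip blk_subset offdiag_less by simp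
  then show "B \<subseteq> {..<l} \<times> V"
    unfolding B cblock_def by auto
  have "card B = (\<Sum>j\<in>{..<l} - {i}. card (blk (offdiag l i j) p))"
    unfolding B cblock_def using ip offdiag_less finite_blk by (auto intro!: card_SigmaI)
  also have "\<dots> = (\<Sum>j\<in>{..<l} - {i}. k)"
    using ip offdiag_less card_blk by (intro sum.cong refl) auto
  finally show "card B = (l - 1) * k" using ip by simp
next
  fix a b assume "a \<in> {..<l} \<times> V" "b \<in> {..<l} \<times> V" "a \<noteq> b"
  then show "size {#B \<in># cblocks. a \<in> B \<and> b \<in> B#} = k * lam"
    using pair_same_colour pair_different_colour
    by (cases a; cases b; cases "fst a = fst b") auto
qed

lemma symmetric_cblocks: "symmetric_design ({..<l} \<times> V) cblocks"
  by (simp add: symmetric_design_def cblocks_def)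

lemma zero_ulse_cblocks:
  "zero_ulse_colouring l {..<l} ((l - 1) * k) ({..<l} \<times> V) cblocks fst"
  unfolding zero_ulse_colouring_def
proof (intro conjI ballI impI)
  have "V \<noteq> {}" using k_less by auto
  then show "colouring l {..<l} ({..<l} \<times> V) fst" by (simp add: colouring_def)
  show "l - 1 dvd (l - 1) * k" by simp
next
  fix B assume "B \<in># cblocks"
  then obtain i p where ip: "i < l" "p \<in> V" and B: "B = cblock (i, p)"
    using mem_cblocks by blast
  \<comment> \<open>Each fibre over \<open>j \<noteq> i\<close> contains \<open>p\<close> and is
    thus nonempty, so only the colour \<open>i\<close> is missing.\<close>
  have "p \<in> blk (offdiag l i j) p" if "j < l" "j \<noteq> i" for j
    using that ip blk_refl offdiag_less by auto
  then have img: "fst ` B = {..<l} - {i}"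
    by (force simp: B cblock_def)
  show "\<exists>!c. c \<in> {..<l} \<and> c \<notin> fst ` B" using img ip by auto
  fix c assume "c \<in> {..<l}" "c \<in> fst ` B"
  then have c: "c < l" "c \<noteq> i" using img by auto
  show "card {b \<in> B. fst b = c} = (l - 1) * k div (l - 1)"
    unfolding B cblock_fibre[OF ip c]
    using c ip offdiag_less card_blk by (auto simp: card_cartesian_product)
qed

end

text \<open>A finite point set injects into the naturals, which moves the design to the point type
  of the theorem.\<close>

lemma coloured_design_exists:
  assumes "affine_resolved_design (V :: 'a set) l blk k lam"
  obtains W :: "nat set" and \<B> and C :: "nat set" and f where
    "bibd (l * card V) ((l - 1) * k) (k * lam) W \<B>" "symmetric_design W \<B>"
    "zero_ulse_colouring l C ((l - 1) * k) W \<B> f"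
proof -
  interpret affine_resolved_design V l blk k lam by fact
  let ?V = "{..<l} \<times> V"
  obtain g :: "nat \<times> 'a \<Rightarrow> nat" where g: "inj_on g ?V"
    using finite_imp_inj_to_nat_seg[of ?V] finite_V by auto
  show ?thesis
  proof (rule that)
    show "bibd (l * card V) ((l - 1) * k) (k * lam) (g ` ?V) (image_mset ((`) g) cblocks)"
      by (rule bibd_image[OF bibd_cblocks g])
    show "symmetric_design (g ` ?V) (image_mset ((`) g) cblocks)"
      using symmetric_cblocks card_image[OF g] by (simp add: symmetric_design_def)
    show "zero_ulse_colouring l {..<l} ((l - 1) * k) (g ` ?V) (image_mset ((`) g) cblocks)
        (fst \<circ> inv_into ?V g)"
      using bibd_cblocks by (intro zero_ulse_colouring_image[OF zero_ulse_cblocks g])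
        (simp add: bibd_def)
  qed
qed

section \<open>Arithmetic of the parameters\<close>

theorem theorem4p6:
  fixes k l v0 k0 lam0 :: nat
  assumes "0 < k" and "0 < l"
    and "(of_nat v0 :: rat) = (of_nat l - 2) * of_nat k / ((of_nat l - 1)^2 - of_nat k)"
    and "(of_nat k0 :: rat) = of_nat k / (of_nat l - 1)"
    and "(of_nat lam0 :: rat) = ((of_nat l - 1)^2 - of_nat k) / (of_nat l - 1)"
    and "\<exists>(V0 :: 'a set) \<B>0. bibd v0 k0 lam0 V0 \<B>0 \<and> resolvable V0 \<B>0"
  shows "\<exists>v :: nat.
    (of_nat v :: rat) = of_nat l * (of_nat l - 2) * of_nat k / ((of_nat l - 1)^2 - of_nat k) \<and>
    (\<forall>lam :: nat.
       (\<exists>m :: nat. 0 < m \<and>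
          (of_nat lam :: rat) =
            of_nat m * (of_nat k * ((of_nat l - 1)^2 - of_nat k) / (of_nat l - 1)^2)) \<longrightarrow>
       (\<exists>(V :: nat set) \<B> (C :: nat set) f.
          bibd v k lam V \<B> \<and> zero_ulse_colouring l C k V \<B> f)) \<and>
    (\<exists>lam :: nat.
       (of_nat lam :: rat) = of_nat k * ((of_nat l - 1)^2 - of_nat k) / (of_nat l - 1)^2 \<and>
       (\<exists>(V :: nat set) \<B> (C :: nat set) f.
          bibd v k lam V \<B> \<and> symmetric_design V \<B> \<and> zero_ulse_colouring l C k V \<B> f))"
proof -
  obtain V0 :: "'a set" and \<B>0 where bibd: "bibd v0 k0 lam0 V0 \<B>0" and res: "resolvable V0 \<B>0"
    using assms(6) by blast
  have k0: "2 \<le> k0" "k0 < v0" and lam0: "0 < lam0" and V0: "finite V0" "card V0 = v0"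
    using bibd by (auto simp: bibd_def)
  define q where "q = l - 1"
  \<comment> \<open>For \<open>l = 1\<close> division by zero would give
    \<open>k0 = 0\<close>.\<close>
  have "l \<noteq> 1" using assms(4) k0 by auto
  then have q: "l = Suc q" "0 < q" using assms(2) by (auto simp: q_def)
  have "of_nat k = (of_nat (q * k0) :: rat)" using assms(4) q by (simp add: field_simps)
  then have k: "k = q * k0" by (simp only: of_nat_eq_iff)
  have diff: "(of_nat q)\<^sup>2 - of_nat k = (of_nat q * of_nat lam0 :: rat)"
    using assms(5) q by (simp add: field_simps)
  have "(of_nat (q * q) :: rat) = of_nat (q * (lam0 + k0))"
    using diff k by (simp add: power2_eq_square algebra_simps)
  then have qlam: "q = lam0 + k0" using q by (simp only: of_nat_eq_iff) simp
  have "(of_nat v0 :: rat) = (of_nat q - 1) * of_nat k / (of_nat q * of_nat lam0)"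
    using assms(3) q unfolding diff[symmetric] by simp
  then have "(of_nat v0 :: rat) * of_nat lam0 = (of_nat q - 1) * of_nat k0"
    using q k lam0 by simp
  then have "(of_nat (v0 * lam0) :: rat) = of_nat ((q - 1) * k0)"
    using q by (simp add: of_nat_diff Suc_leI)
  then have v0: "v0 * lam0 = (q - 1) * k0" by (simp only: of_nat_eq_iff)
  obtain r :: nat and blk where design: "resolved_design V0 {..<r} blk k0 lam0"
    using resolvable_resolved_design[OF bibd res] .
  obtain x where "x \<in> V0" using V0 k0 by fastforce
  \<comment> \<open>Here \<open>(v0 - 1) * lam0 = (q - 1) * k0 - (q - k0) = q * (k0 - 1)\<close>,
    which forces exactly \<open>q\<close> classes.\<close>
  then have "r * (k0 - 1) = (v0 - 1) * lam0"
    using resolved_design.replication[OF design] V0 by simp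
  also have "\<dots> = q * (k0 - 1)"
    using v0 qlam k0 by (simp add: diff_mult_distrib diff_mult_distrib2)
  finally have "r = q" using k0 by simp
  then have "affine_resolved_design V0 l blk k0 lam0"
    using design k0 lam0 V0 v0 qlam q
    by (simp add: affine_resolved_design_def affine_resolved_design_axioms_def)
  then obtain W :: "nat set" and \<B> and C :: "nat set" and f where
    W: "bibd (l * v0) k (k0 * lam0) W \<B>" "symmetric_design W \<B>"
      "zero_ulse_colouring l C k W \<B> f"
    using coloured_design_exists k q V0 by (metis diff_Suc_1)
  have v_eq: "(of_nat (l * v0) :: rat) =
      of_nat l * (of_nat l - 2) * of_nat k / ((of_nat l - 1)^2 - of_nat k)"
    using assms(3) by simp
  \<comment> \<open>With \<open>k = q * k0\<close> and \<open>diff\<close>, the numerator is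
    \<open>q * q * k0 * lam0\<close>.\<close>
  have lam_eq: "of_nat k * ((of_nat l - 1)^2 - of_nat k) / (of_nat l - 1)^2 =
      (of_nat (k0 * lam0) :: rat)"
    using diff q k by (simp add: power2_eq_square)
  show ?thesis
  proof (rule exI[of _ "l * v0"], intro conjI allI impI)
    show "(of_nat (l * v0) :: rat) =
        of_nat l * (of_nat l - 2) * of_nat k / ((of_nat l - 1)^2 - of_nat k)"
      by (rule v_eq)
  next
    fix lam :: nat
    assume "\<exists>m :: nat. 0 < m \<and> (of_nat lam :: rat) =
        of_nat m * (of_nat k * ((of_nat l - 1)^2 - of_nat k) / (of_nat l - 1)^2)"
    then obtain m where m: "0 < m" "(of_nat lam :: rat) = of_nat m * of_nat (k0 * lam0)"
      unfolding lam_eq by blast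
    have "lam = m * (k0 * lam0)"
      using m(2) unfolding of_nat_mult[symmetric] of_nat_eq_iff .
    then show "\<exists>(V :: nat set) \<B> (C :: nat set) f.
        bibd (l * v0) k lam V \<B> \<and> zero_ulse_colouring l C k V \<B> f"
      using bibd_repeat[OF W(1) m(1)] zero_ulse_colouring_repeat[OF W(3)] by blast
  next
    show "\<exists>lam :: nat.
       (of_nat lam :: rat) = of_nat k * ((of_nat l - 1)^2 - of_nat k) / (of_nat l - 1)^2 \<and>
       (\<exists>(V :: nat set) \<B> (C :: nat set) f.
          bibd (l * v0) k lam V \<B> \<and> symmetric_design V \<B> \<and> zero_ulse_colouring l C k V \<B> f)"
      using W lam_eq by metis
  qed
qed

end
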